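(* For each boundary-compatible singular sector $\sigma\in\Sigma_{\mathrm{bc}}$ of $G$ let $N_\sigma$ be a full-column-rank matrix whose columns form a basis of $\ker B_{\sigma,\mathrm{bc}}$. For $d\in\mathbb R^E$ put $D_d=\operatorname{diag}(d_e)$. Then $d$ belongs to the dual cone $(\mathcal M_G^{\mathrm{bc}})^*=\{d\in\mathbb R^E:d\cdot s\ge0\ \forall s\in\mathcal M_G^{\mathrm{bc}}\}$ if and only if $$N_\sigma^*D_dN_\sigma\succeq0\qquad\text{for every }\sigma\in\Sigma_{\mathrm{bc}}.$$ Equivalently, $A^*D_dA\ge0$ for every $A\in\ker B_{\sigma,\mathrm{bc}}$ and every $\sigma\in\Sigma_{\mathrm{bc}}$.
   Context: Let $G=(V,E)$ be a finite metric graph (loops and multiple edges allowed), whose vertices are split into internal vertices $V_{\mathrm{int}}$ (standard Kirchhoff conditions) and degree-one exterior vertices, each carrying a Dirichlet or a Neumann condition; every edge has at least one internal endpoint. Orient the edges, terminal edges from the internal to the exterior endpoint. A boundary-compatible singular sector $\sigma$ consists of: a parity $\sigma_e=\cos\theta_e\in\{\pm1\}$, $\theta_e\in\pi\mathbb Z$, for each internal--internal edge; a phase class $\theta_e\in\pi\mathbb Z$ for each internal--Dirichlet edge; a phase class $\theta_e\in\frac\pi2+\pi\mathbb Z$ for each internal--Neumann edge. The matrix $B_{\sigma,\mathrm{bc}}\in\mathbb R^{V_{\mathrm{int}}\times E}$ has: for a non-loop internal--internal edge from $v_-$ to $v_+$, entries $1$ in row $v_-$ and $-\sigma_e$ in row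 $v_+$; for a loop at $v$, entry $1-\sigma_e$ in row $v$; for a terminal edge at internal vertex $v$, entry $1$ in row $v$; all other entries zero. $\Sigma_{\mathrm{bc}}$ is the finite collection of sectors (modulo multiplication of $B_{\sigma,\mathrm{bc}}$ on left and right by diagonal $\pm1$ matrices). For $A\in\mathbb R^E$, $A^{\circ2}=(A_e^2)_{e\in E}$. $\mathcal M_G^{\mathrm{bc}}$ is the convex cone generated by $\bigcup_{\sigma\in\Sigma_{\mathrm{bc}}}\{A^{\circ2}:A\in\ker B_{\sigma,\mathrm{bc}}\}$. *)

theory Defs
  imports
    Complex_Main
    "HOL.Hull"
    "Graph_Theory.Digraph"
    "Jordan_Normal_Form.Matrix_Kernel"
    "Jordan_Normal_Form.DL_Rank"
begin

section \<open>Metric graphs with boundary conditions\<close>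

datatype vertex_condition = Kirchhoff | Dirichlet | Neumann

text \<open>
  The orientation of the edges is the one carried by \<^typ>\<open>('v, 'e) pre_digraph\<close>.
  The internal vertices are those with the Kirchhoff condition. Demanding that every tail
  is internal says at once that every edge has an internal endpoint and that terminal edges
  point from the internal to the exterior endpoint. A loop contributes 2 to the degree.
  Connectedness is not assumed.
\<close>

locale bc_metric_graph = fin_digraph G
  for G :: "('v, 'e) pre_digraph" +
  fixes len :: "'e \<Rightarrow> real"
    and bc :: "'v \<Rightarrow> vertex_condition"
  assumes len_pos: "e \<in> arcs G \<Longrightarrow> len e > 0"
    and exterior_degree_one:
      "\<lbrakk>v \<in> verts G; bc v \<noteq> Kirchhoff\<rbrakk> \<Longrightarrow> in_degree G v + out_degree G v = 1"
    and tail_internal: "e \<in> arcs G \<Longrightarrow> bc (tail G e) = Kirchhoff"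

definition internal_verts :: "('v, 'e) pre_digraph \<Rightarrow> ('v \<Rightarrow> vertex_condition) \<Rightarrow> 'v set" where
  "internal_verts G bc = {v \<in> verts G. bc v = Kirchhoff}"

section \<open>Boundary-compatible singular sectors\<close>

definition phases ::
  "('v, 'e) pre_digraph \<Rightarrow> ('v \<Rightarrow> vertex_condition) \<Rightarrow> 'e \<Rightarrow> real set" where
  "phases G bc e = (case bc (head G e) of
      Kirchhoff \<Rightarrow> {of_int k * pi | k :: int. True}
    | Dirichlet \<Rightarrow> {of_int k * pi | k :: int. True}
    | Neumann \<Rightarrow> {pi / 2 + of_int k * pi | k :: int. True})"

text \<open>
  A sector is given by a choice of phases representing its phase classes; different choices
  for the same parities yield the same matrix and are identified in \<open>Sigma_bc\<close> below.
\<close>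

definition sectors ::
  "('v, 'e) pre_digraph \<Rightarrow> ('v \<Rightarrow> vertex_condition) \<Rightarrow> ('e \<Rightarrow> real) set" where
  "sectors G bc = (\<Pi>\<^sub>E e \<in> arcs G. phases G bc e)"

definition parity :: "('e \<Rightarrow> real) \<Rightarrow> 'e \<Rightarrow> real" where
  "parity \<theta> e = cos (\<theta> e)"

definition B_entry ::
  "('v, 'e) pre_digraph \<Rightarrow> ('v \<Rightarrow> vertex_condition) \<Rightarrow> ('e \<Rightarrow> real) \<Rightarrow> 'v \<Rightarrow> 'e \<Rightarrow> real" where
  "B_entry G bc \<theta> v e =
    (if bc (head G e) \<noteq> Kirchhoff then (if v = tail G e then 1 else 0)
     else if tail G e = head G e then (if v = tail G e then 1 - parity \<theta> e else 0)
     else if v = tail G e then 1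
     else if v = head G e then - parity \<theta> e
     else 0)"

text \<open>
  The lists \<open>vs\<close> and \<open>es\<close> enumerate the internal vertices and the edges. They fix the
  coordinates, so that \<^term>\<open>carrier_vec (length es)\<close> is the space of real vectors
  indexed by the edges.
\<close>

definition B_mat ::
  "('v, 'e) pre_digraph \<Rightarrow> ('v \<Rightarrow> vertex_condition) \<Rightarrow> 'v list \<Rightarrow> 'e list \<Rightarrow>
    ('e \<Rightarrow> real) \<Rightarrow> real mat" where
  "B_mat G bc vs es \<theta> =
    mat (length vs) (length es) (\<lambda>(i, j). B_entry G bc \<theta> (vs ! i) (es ! j))"

definition sign_equivalent :: "real mat \<Rightarrow> real mat \<Rightarrow> bool" where
  "sign_equivalent A B \<longleftrightarrow>
    (\<exists>s t. range s \<subseteq> {1, -1} \<and> range t \<subseteq> {1, -1} \<and>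
       B = mat_diag (dim_row A) s * A * mat_diag (dim_col A) t)"

definition sector_rel ::
  "('v, 'e) pre_digraph \<Rightarrow> ('v \<Rightarrow> vertex_condition) \<Rightarrow> 'v list \<Rightarrow> 'e list \<Rightarrow>
    (('e \<Rightarrow> real) \<times> ('e \<Rightarrow> real)) set" where
  "sector_rel G bc vs es =
    {(\<theta>, \<theta>'). \<theta> \<in> sectors G bc \<and> \<theta>' \<in> sectors G bc \<and>
       sign_equivalent (B_mat G bc vs es \<theta>) (B_mat G bc vs es \<theta>')}"

definition Sigma_bc ::
  "('v, 'e) pre_digraph \<Rightarrow> ('v \<Rightarrow> vertex_condition) \<Rightarrow> 'v list \<Rightarrow> 'e list \<Rightarrow>
    ('e \<Rightarrow> real) set set" where
  "Sigma_bc G bc vs es = sectors G bc // sector_rel G bc vs es"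

section \<open>Cones\<close>

definition vec_convex_cone :: "nat \<Rightarrow> real vec set \<Rightarrow> bool" where
  "vec_convex_cone n C \<longleftrightarrow>
    C \<subseteq> carrier_vec n \<and> 0\<^sub>v n \<in> C \<and>
    (\<forall>x \<in> C. \<forall>y \<in> C. x + y \<in> C) \<and> (\<forall>x \<in> C. \<forall>a \<ge> 0. a \<cdot>\<^sub>v x \<in> C)"

definition dual_cone :: "nat \<Rightarrow> real vec set \<Rightarrow> real vec set" where
  "dual_cone n C = {d \<in> carrier_vec n. \<forall>s \<in> C. d \<bullet> s \<ge> 0}"

definition square_vec :: "real vec \<Rightarrow> real vec" where
  "square_vec A = map_vec (\<lambda>x. x\<^sup>2) A"

text \<open>
  Multiplying \<open>B\<close> by diagonal sign matrices changes its kernel only by signs of coordinates,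
  so all members \<open>\<theta>\<close> of one class \<open>\<sigma>\<close> contribute the same squares.
\<close>

definition M_cone ::
  "('v, 'e) pre_digraph \<Rightarrow> ('v \<Rightarrow> vertex_condition) \<Rightarrow> 'v list \<Rightarrow> 'e list \<Rightarrow> real vec set" where
  "M_cone G bc vs es =
    vec_convex_cone (length es) hull
      (\<Union>\<sigma> \<in> Sigma_bc G bc vs es. \<Union>\<theta> \<in> \<sigma>.
         square_vec ` mat_kernel (B_mat G bc vs es \<theta>))"

section \<open>Matrices\<close>

definition kernel_basis_mat :: "real mat \<Rightarrow> real mat \<Rightarrow> bool" where
  "kernel_basis_mat B N \<longleftrightarrow>
    dim_row N = dim_col B \<and>
    vec_space.rank (dim_col B) N = dim_col N \<and>
    kernel.basis (dim_col B) B (set (cols N))"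

definition pos_semidef :: "real mat \<Rightarrow> bool" where
  "pos_semidef M \<longleftrightarrow>
    M \<in> carrier_mat (dim_row M) (dim_row M) \<and> M\<^sup>T = M \<and>
    (\<forall>x \<in> carrier_vec (dim_row M). x \<bullet> (M *\<^sub>v x) \<ge> 0)"

definition diag_of_vec :: "real vec \<Rightarrow> real mat" where
  "diag_of_vec d = mat_diag (dim_vec d) (\<lambda>i. d $ i)"

section \<open>Well-definedness of the collection of sectors\<close>

lemma sign_equivalent_refl: "sign_equivalent A A"
  unfolding sign_equivalent_def
  by (rule exI[of _ "\<lambda>_. 1"], rule exI[of _ "\<lambda>_. 1"]) auto

lemma sign_equivalent_alt:
  assumes A: "A \<in> carrier_mat n m"
  shows "sign_equivalent A B \<longleftrightarrow>
    (\<exists>s t. range s \<subseteq> {1, -1} \<and> range t \<subseteq> {1, -1} \<and>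
       B = mat n m (\<lambda>(i, j). s i * A $$ (i, j) * t j))"
proof -
  have "mat_diag (dim_row A) s * A * mat_diag (dim_col A) t =
      mat n m (\<lambda>(i, j). s i * A $$ (i, j) * t j)" for s t :: "nat \<Rightarrow> real"
    using A by (auto simp: mat_diag_mult_left[of A n m] mat_diag_mult_right[of _ n m] intro!: eq_matI)
  then show ?thesis
    unfolding sign_equivalent_def by simp
qed

lemma sign_equivalent_sym:
  assumes A: "A \<in> carrier_mat n m" and eq: "sign_equivalent A B"
  shows "sign_equivalent B A"
proof -
  obtain s t :: "nat \<Rightarrow> real" where st: "range s \<subseteq> {1, -1}" "range t \<subseteq> {1, -1}"
      and B: "B = mat n m (\<lambda>(i, j). s i * A $$ (i, j) * t j)"
    using eq unfolding sign_equivalent_alt[OF A] by blast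
  have "s i * s i = 1" "t i * t i = 1" for i
    using st by (auto simp: image_subset_iff dest!: spec[of _ i])
  then have sq: "s i * (s i * x * t j) * t j = x" for i j x
    by (metis mult.assoc mult.commute mult_1)
  have BC: "B \<in> carrier_mat n m"
    using B by simp
  have "A = mat n m (\<lambda>(i, j). s i * B $$ (i, j) * t j)"
    using A by (auto simp: B sq intro!: eq_matI)
  then show ?thesis
    unfolding sign_equivalent_alt[OF BC] using st by blast
qed

lemma sign_equivalent_trans:
  assumes A: "A \<in> carrier_mat n m" and "sign_equivalent A B" "sign_equivalent B C"
  shows "sign_equivalent A C"
proof -
  obtain s t :: "nat \<Rightarrow> real" where st: "range s \<subseteq> {1, -1}" "range t \<subseteq> {1, -1}"
      and B: "B = mat n m (\<lambda>(i, j). s i * A $$ (i, j) * t j)"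
    using assms(2) unfolding sign_equivalent_alt[OF A] by blast
  have BC: "B \<in> carrier_mat n m"
    using B by simp
  obtain s' t' :: "nat \<Rightarrow> real" where st': "range s' \<subseteq> {1, -1}" "range t' \<subseteq> {1, -1}"
      and C: "C = mat n m (\<lambda>(i, j). s' i * B $$ (i, j) * t' j)"
    using assms(3) unfolding sign_equivalent_alt[OF BC] by blast
  have "range (\<lambda>i. s' i * s i) \<subseteq> {1, -1}" "range (\<lambda>i. t i * t' i) \<subseteq> {1, -1}"
    using st st' by (auto simp: image_subset_iff) (metis minus_minus mult.commute mult_1 mult_minus_left)+
  moreover have "C = mat n m (\<lambda>(i, j). (s' i * s i) * A $$ (i, j) * (t j * t' j))"
    using A by (auto simp: B C intro!: eq_matI)
  ultimately show ?thesis
    unfolding sign_equivalent_alt[OF A]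
    by (intro exI[of _ "\<lambda>i. s' i * s i"] exI[of _ "\<lambda>i. t i * t' i"]) simp
qed

lemma equiv_sector_rel: "equiv (sectors G bc) (sector_rel G bc vs es)"
proof (rule equivI)
  have B: "B_mat G bc vs es \<theta> \<in> carrier_mat (length vs) (length es)" for \<theta>
    by (simp add: B_mat_def)
  show "sector_rel G bc vs es \<subseteq> sectors G bc \<times> sectors G bc"
    by (auto simp: sector_rel_def)
  show "refl_on (sectors G bc) (sector_rel G bc vs es)"
    by (auto simp: refl_on_def sector_rel_def sign_equivalent_refl)
  show "sym (sector_rel G bc vs es)"
    using sign_equivalent_sym[OF B] by (auto simp: sym_def sector_rel_def)
  show "trans (sector_rel G bc vs es)"
    unfolding trans_def sector_rel_def using sign_equivalent_trans[OF B] by blast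
qed

lemma finite_Sigma_bc:
  assumes "set es \<subseteq> arcs G"
  shows "finite (Sigma_bc G bc vs es)"
proof -
  let ?B = "B_mat G bc vs es"
  let ?F = "{f \<in> (UNIV :: (nat \<times> nat) set) \<rightarrow> {-1, 0, 1, 2 :: real}.
     \<forall>p. p \<notin> {..<length vs} \<times> {..<length es} \<longrightarrow> f p = 0}"
  have "finite ?F"
  proof (rule finite_subset)
    show "?F \<subseteq> {f. \<forall>p. (p \<in> {..<length vs} \<times> {..<length es} \<longrightarrow> f p \<in> {-1, 0, 1, 2}) \<and>
      (p \<notin> {..<length vs} \<times> {..<length es} \<longrightarrow> f p = 0)}"
      by auto
    show "finite \<dots>"
      by (rule finite_set_of_finite_funs) auto
  qed
  moreover have "?B ` sectors G bc \<subseteq> mat (length vs) (length es) ` ?F"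
  proof (rule image_subsetI)
    fix \<theta> assume \<theta>: "\<theta> \<in> sectors G bc"
    define f where "f = (\<lambda>p :: nat \<times> nat. if p \<in> {..<length vs} \<times> {..<length es}
      then B_entry G bc \<theta> (vs ! fst p) (es ! snd p) else 0)"
    have entry: "B_entry G bc \<theta> v e \<in> {-1, 0, 1, 2}" if "e \<in> arcs G" for v e
    proof -
      have "cos (\<theta> e) \<in> {1, -1}" if K: "bc (head G e) = Kirchhoff"
      proof -
        have "\<theta> e \<in> phases G bc e"
          using \<theta> \<open>e \<in> arcs G\<close> unfolding sectors_def by (rule PiE_mem)
        then obtain k :: int where "\<theta> e = of_int k * pi"
          using K by (auto simp: phases_def)
        then have "sin (\<theta> e) = 0"
          by (auto simp: sin_zero_iff_int2)
        then have "(cos (\<theta> e))\<^sup>2 = 1"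
          by (simp add: cos_squared_eq)
        then show ?thesis
          by (auto simp: power2_eq_1_iff)
      qed
      then show ?thesis
        by (auto simp: B_entry_def parity_def)
    qed
    have "f p \<in> {-1, 0, 1, 2}" for p
    proof (cases "p \<in> {..<length vs} \<times> {..<length es}")
      case True
      then have "es ! snd p \<in> arcs G"
        using assms nth_mem[of "snd p" es] by auto
      from entry[OF this, of "vs ! fst p"] show ?thesis
        using True by (simp only: f_def if_True)
    qed (simp only: f_def if_False, simp)
    then have "f \<in> ?F"
      by (auto simp: f_def)
    moreover have "?B \<theta> = mat (length vs) (length es) f"
      by (auto simp: B_mat_def f_def intro!: eq_matI)
    ultimately show "?B \<theta> \<in> mat (length vs) (length es) ` ?F"
      by blast
  qed
  ultimately have fin: "finite (?B ` sectors G bc)"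
    by (meson finite_imageI finite_subset)
  have "Sigma_bc G bc vs es \<subseteq>
    (\<lambda>b. {\<theta>' \<in> sectors G bc. sign_equivalent b (?B \<theta>')}) ` ?B ` sectors G bc"
    by (auto simp: Sigma_bc_def quotient_def sector_rel_def image_iff)
  then show ?thesis
    using fin finite_subset by blast
qed

end

theory Submission
  imports Defs
begin

text \<open>
  A functional is nonnegative on a convex cone if and only if it is nonnegative on a set of
  generators. The cone of the graph is generated by the entrywise squares \<open>A\<^sup>2\<close> of kernel
  vectors \<open>A\<close>, and pairing \<open>d\<close> with \<open>A\<^sup>2\<close> gives \<open>\<Sum>\<^sub>e d\<^sub>e A\<^sub>e\<^sup>2\<close>, the quadratic form of the
  diagonal matrix of \<open>d\<close> at \<open>A\<close> (lemma \<open>diag_quadratic_form\<close>). So membership in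
  the dual cone says exactly that this form is nonnegative on every kernel.

  Two points remain. The cone collects the squares over all members of a sector class, whereas
  the matrix conditions look at one representative; this makes no difference because
  multiplying a matrix by diagonal sign matrices flips the signs of some coordinates of its
  kernel vectors, and squaring forgets signs (lemma \<open>square_kernel_sign_equivalent\<close>). And
  since the columns of \<open>N\<close> span the kernel, substituting \<open>A = N x\<close> turns nonnegativity of
  the form on the kernel into positive semidefiniteness of \<open>N\<^sup>T D N\<close>
  (lemma \<open>pos_semidef_congruence_iff\<close>).
\<close>

section \<open>Duality between squares and quadratic forms\<close>

lemma diag_mult_vec_index:
  fixes f :: "nat \<Rightarrow> real"
  assumes "x \<in> carrier_vec n" "i < n"
  shows "(mat_diag n f *\<^sub>v x) $ i = f i * x $ i"
proof -
  have "(mat_diag n f *\<^sub>v x) $ i = (\<Sum>j = 0..<n. (if i = j then f j else 0) * x $ j)"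
    using assms by (simp add: mat_diag_def scalar_prod_def)
  also have "\<dots> = (\<Sum>j = 0..<n. if i = j then f j * x $ j else 0)"
    by (rule sum.cong) auto
  finally show ?thesis
    using assms by simp
qed

lemma diag_quadratic_form:
  assumes "d \<in> carrier_vec n" "x \<in> carrier_vec n"
  shows "x \<bullet> (diag_of_vec d *\<^sub>v x) = d \<bullet> square_vec x"
proof -
  have "x \<bullet> (diag_of_vec d *\<^sub>v x) = (\<Sum>i = 0..<n. x $ i * (d $ i * x $ i))"
    unfolding scalar_prod_def diag_of_vec_def using assms
    by (intro sum.cong)
      (auto simp: diag_mult_vec_index carrier_matD(1)[OF mat_diag_dim] simp del: index_mult_mat_vec)
  also have "\<dots> = d \<bullet> square_vec x"
    using assms by (auto simp: scalar_prod_def square_vec_def power2_eq_square intro!: sum.cong)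
  finally show ?thesis .
qed

text \<open>
  The vectors on which \<open>d\<close> is nonnegative form a convex cone themselves (a half-space), so
  they contain the hull as soon as they contain the generators.
\<close>

lemma dual_cone_hull:
  assumes "S \<subseteq> carrier_vec n"
  shows "dual_cone n (vec_convex_cone n hull S) = dual_cone n S"
proof (intro equalityI subsetI)
  fix d assume "d \<in> dual_cone n (vec_convex_cone n hull S)"
  then show "d \<in> dual_cone n S"
    by (auto simp: dual_cone_def intro: hull_inc)
next
  fix d assume d: "d \<in> dual_cone n S"
  let ?H = "{s \<in> carrier_vec n. d \<bullet> s \<ge> 0}"
  have "vec_convex_cone n ?H"
    using d by (auto simp: vec_convex_cone_def dual_cone_def scalar_prod_add_distrib[of _ n])
  moreover have "S \<subseteq> ?H"
    using d assms by (auto simp: dual_cone_def)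
  ultimately have "vec_convex_cone n hull S \<subseteq> ?H"
    by (rule hull_minimal[rotated])
  then show "d \<in> dual_cone n (vec_convex_cone n hull S)"
    using d by (auto simp: dual_cone_def)
qed

section \<open>Kernels of sign equivalent matrices\<close>

text \<open>
  If \<open>B = S A T\<close> with \<open>S\<close>, \<open>T\<close> diagonal sign matrices and \<open>B v = 0\<close>, then \<open>T v\<close> lies in the
  kernel of \<open>A\<close>, because \<open>S\<close> is its own inverse, and it has the same squares as \<open>v\<close>.
\<close>

lemma square_kernel_sign_equivalent_subset:
  assumes A: "A \<in> carrier_mat n m" and eq: "sign_equivalent A B"
  shows "square_vec ` mat_kernel B \<subseteq> square_vec ` mat_kernel A"
proof (rule image_subsetI)
  fix v assume v: "v \<in> mat_kernel B"
  obtain s t :: "nat \<Rightarrow> real" where s: "range s \<subseteq> {1, -1}" and t: "range t \<subseteq> {1, -1}"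
      and B: "B = mat_diag n s * A * mat_diag m t"
    using eq A unfolding sign_equivalent_def by auto
  have BC: "B \<in> carrier_mat n m"
    unfolding B by (rule mult_carrier_mat[OF mult_carrier_mat[OF mat_diag_dim A] mat_diag_dim])
  note vC = mat_kernelD[OF BC v]
  define w where "w = mat_diag m t *\<^sub>v v"
  have wC: "w \<in> carrier_vec m"
    unfolding w_def using vC(1) by (rule mult_mat_vec_carrier[OF mat_diag_dim])
  have "s i * s i = 1" for i
    using s by (auto simp: image_subset_iff dest!: spec[of _ i])
  then have ss: "mat_diag n s * mat_diag n s = 1\<^sub>m n"
    by simp
  have "mat_diag n s *\<^sub>v (A *\<^sub>v w) = B *\<^sub>v v"
  proof -
    have "B *\<^sub>v v = (mat_diag n s * A) *\<^sub>v w"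
      unfolding B w_def
      by (rule assoc_mult_mat_vec[OF mult_carrier_mat[OF mat_diag_dim A] mat_diag_dim vC(1)])
    also have "\<dots> = mat_diag n s *\<^sub>v (A *\<^sub>v w)"
      by (rule assoc_mult_mat_vec[OF mat_diag_dim A wC])
    finally show ?thesis ..
  qed
  then have "mat_diag n s *\<^sub>v (A *\<^sub>v w) = 0\<^sub>v n"
    using vC(2) by simp
  then have "(mat_diag n s * mat_diag n s) *\<^sub>v (A *\<^sub>v w) = mat_diag n s *\<^sub>v 0\<^sub>v n"
    using assoc_mult_mat_vec[OF mat_diag_dim mat_diag_dim mult_mat_vec_carrier[OF A wC]] by simp
  then have "A *\<^sub>v w = 0\<^sub>v n"
    unfolding ss using mult_mat_vec_carrier[OF A wC] by (auto simp: mat_diag_def)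
  then have "w \<in> mat_kernel A"
    by (rule mat_kernelI[OF A wC])
  moreover have "square_vec v = square_vec w"
  proof (rule eq_vecI)
    have "(t i)\<^sup>2 = 1" for i
      using t by (auto simp: image_subset_iff dest!: spec[of _ i])
    then show "square_vec v $ i = square_vec w $ i" if "i < dim_vec (square_vec w)" for i
      using that vC(1) wC
      by (simp add: square_vec_def w_def diag_mult_vec_index power_mult_distrib
          carrier_matD(1)[OF mat_diag_dim] del: index_mult_mat_vec)
  qed (use vC(1) wC in \<open>simp add: square_vec_def\<close>)
  ultimately show "square_vec v \<in> square_vec ` mat_kernel A"
    by blast
qed

lemma square_kernel_sign_equivalent:
  assumes A: "A \<in> carrier_mat n m" and eq: "sign_equivalent A B"
  shows "square_vec ` mat_kernel B = square_vec ` mat_kernel A"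
proof
  have B: "B \<in> carrier_mat n m"
    using eq A by (auto simp: sign_equivalent_alt[OF A])
  show "square_vec ` mat_kernel A \<subseteq> square_vec ` mat_kernel B"
    by (rule square_kernel_sign_equivalent_subset[OF B sign_equivalent_sym[OF A eq]])
qed (rule square_kernel_sign_equivalent_subset[OF A eq])

section \<open>Restricting a quadratic form to a kernel\<close>

text \<open>
  The notion of basis refers to the span inside the kernel as a vector space of its own, which
  agrees with the span in the ambient space and hence with the column space of \<open>N\<close>.
\<close>

lemma kernel_basis_mat_range:
  assumes "kernel_basis_mat B N"
  shows "mat_kernel B = (\<lambda>x. N *\<^sub>v x) ` carrier_vec (dim_col N)"
proof -
  interpret kernel "dim_row B" "dim_col B" B
    by unfold_locales simp
  have N: "N \<in> carrier_mat (dim_col B) (dim_col N)"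
    and "basis (set (cols N))"
    using assms by (auto simp: kernel_basis_mat_def)
  then have sub: "set (cols N) \<subseteq> mat_kernel B" and "span (set (cols N)) = mat_kernel B"
    by (auto simp: Ker.basis_def)
  then have "mat_kernel B = NC.col_space N"
    by (simp add: span_same NC.col_space_def)
  also have "\<dots> = (\<lambda>x. N *\<^sub>v x) ` carrier_vec (dim_col N)"
    unfolding NC.col_space_eq[OF N] by (auto simp: mult_mat_vec_def)
  finally show ?thesis .
qed

lemma pos_semidef_congruence_iff:
  assumes M: "M \<in> carrier_mat n n" and sym: "M\<^sup>T = M" and N: "N \<in> carrier_mat n k"
  shows "pos_semidef (N\<^sup>T * M * N) \<longleftrightarrow>
    (\<forall>A \<in> (\<lambda>x. N *\<^sub>v x) ` carrier_vec k. A \<bullet> (M *\<^sub>v A) \<ge> 0)"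
proof -
  have NT: "N\<^sup>T \<in> carrier_mat k n" and NTM: "N\<^sup>T * M \<in> carrier_mat k n"
    and MN: "M * N \<in> carrier_mat n k"
    using M N by auto
  have assoc: "N\<^sup>T * M * N = N\<^sup>T * (M * N)"
    by (rule assoc_mult_mat[OF NT M N])
  have "(N\<^sup>T * M * N)\<^sup>T = N\<^sup>T * (N\<^sup>T * M)\<^sup>T"
    by (rule transpose_mult[OF NTM N])
  also have "(N\<^sup>T * M)\<^sup>T = M * N"
    using transpose_mult[OF NT M] by (simp add: sym)
  finally have symN: "(N\<^sup>T * M * N)\<^sup>T = N\<^sup>T * M * N"
    by (simp add: assoc)
  have form: "x \<bullet> ((N\<^sup>T * M * N) *\<^sub>v x) = (N *\<^sub>v x) \<bullet> (M *\<^sub>v (N *\<^sub>v x))"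
    if x: "x \<in> carrier_vec k" for x
  proof -
    have Nx: "N *\<^sub>v x \<in> carrier_vec n" and MNx: "M *\<^sub>v (N *\<^sub>v x) \<in> carrier_vec n"
      using M N x by auto
    have "(N\<^sup>T * M * N) *\<^sub>v x = N\<^sup>T *\<^sub>v (M *\<^sub>v (N *\<^sub>v x))"
      using assoc_mult_mat_vec[OF NTM N x] assoc_mult_mat_vec[OF NT M Nx] by simp
    then have "x \<bullet> ((N\<^sup>T * M * N) *\<^sub>v x) = (N\<^sup>T *\<^sub>v (M *\<^sub>v (N *\<^sub>v x))) \<bullet> x"
      using comm_scalar_prod[OF x mult_mat_vec_carrier[OF NT MNx]] by simp
    also have "\<dots> = (M *\<^sub>v (N *\<^sub>v x)) \<bullet> (N *\<^sub>v x)"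
      by (rule transpose_vec_mult_scalar[OF N x MNx])
    also have "\<dots> = (N *\<^sub>v x) \<bullet> (M *\<^sub>v (N *\<^sub>v x))"
      by (rule comm_scalar_prod[OF MNx Nx])
    finally show ?thesis .
  qed
  have "N\<^sup>T * M * N \<in> carrier_mat k k"
    using NTM N by auto
  then show ?thesis
    by (auto simp: pos_semidef_def symN form)
qed

section \<open>The dual cone of a graph\<close>

text \<open>
  Any two members of a class of sectors have sign equivalent matrices, so one representative
  of each class yields all generators.
\<close>

lemma M_cone_generated_by_representatives:
  assumes rep: "\<And>\<sigma>. \<sigma> \<in> Sigma_bc G bc vs es \<Longrightarrow> rep \<sigma> \<in> \<sigma>"
  shows "M_cone G bc vs es = vec_convex_cone (length es) hull
    (\<Union>\<sigma> \<in> Sigma_bc G bc vs es. square_vec ` mat_kernel (B_mat G bc vs es (rep \<sigma>)))"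
proof -
  have B: "B_mat G bc vs es \<theta> \<in> carrier_mat (length vs) (length es)" for \<theta>
    by (simp add: B_mat_def)
  have "(\<Union>\<theta> \<in> \<sigma>. square_vec ` mat_kernel (B_mat G bc vs es \<theta>)) =
      square_vec ` mat_kernel (B_mat G bc vs es (rep \<sigma>))"
    if \<sigma>: "\<sigma> \<in> Sigma_bc G bc vs es" for \<sigma>
  proof -
    have "square_vec ` mat_kernel (B_mat G bc vs es \<theta>) =
        square_vec ` mat_kernel (B_mat G bc vs es (rep \<sigma>))" if \<theta>: "\<theta> \<in> \<sigma>" for \<theta>
    proof -
      have "(rep \<sigma>, \<theta>) \<in> sector_rel G bc vs es"
        using quotient_eq_iff[OF equiv_sector_rel \<sigma>[unfolded Sigma_bc_def]
            \<sigma>[unfolded Sigma_bc_def] rep[OF \<sigma>] \<theta>] by simp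
      then show ?thesis
        by (intro square_kernel_sign_equivalent[OF B]) (simp add: sector_rel_def)
    qed
    then show ?thesis
      using rep[OF \<sigma>] by blast
  qed
  then show ?thesis
    by (simp add: M_cone_def)
qed

theorem proposition4p10:
  fixes G :: "('v, 'e) pre_digraph"
    and len :: "'e \<Rightarrow> real"
    and bc :: "'v \<Rightarrow> vertex_condition"
    and vs :: "'v list"
    and es :: "'e list"
    and rep :: "('e \<Rightarrow> real) set \<Rightarrow> ('e \<Rightarrow> real)"
    and N :: "('e \<Rightarrow> real) set \<Rightarrow> real mat"
    and d :: "real vec"
  assumes "bc_metric_graph G len bc"
    and "distinct vs" and "set vs = internal_verts G bc"
    and "distinct es" and "set es = arcs G"
    and "\<And>\<sigma>. \<sigma> \<in> Sigma_bc G bc vs es \<Longrightarrow> rep \<sigma> \<in> \<sigma>"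
    and "\<And>\<sigma>. \<sigma> \<in> Sigma_bc G bc vs es \<Longrightarrow>
           kernel_basis_mat (B_mat G bc vs es (rep \<sigma>)) (N \<sigma>)"
    and "d \<in> carrier_vec (length es)"
  shows "(d \<in> dual_cone (length es) (M_cone G bc vs es) \<longleftrightarrow>
            (\<forall>\<sigma> \<in> Sigma_bc G bc vs es. pos_semidef ((N \<sigma>)\<^sup>T * diag_of_vec d * N \<sigma>))) \<and>
         (d \<in> dual_cone (length es) (M_cone G bc vs es) \<longleftrightarrow>
            (\<forall>\<sigma> \<in> Sigma_bc G bc vs es. \<forall>A \<in> mat_kernel (B_mat G bc vs es (rep \<sigma>)).
               A \<bullet> (diag_of_vec d *\<^sub>v A) \<ge> 0))"
proof -
  let ?n = "length es" and ?\<Sigma> = "Sigma_bc G bc vs es"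
  let ?K = "\<lambda>\<sigma>. mat_kernel (B_mat G bc vs es (rep \<sigma>))"
  note d = \<open>d \<in> carrier_vec (length es)\<close>
  have B: "B_mat G bc vs es \<theta> \<in> carrier_mat (length vs) ?n" for \<theta>
    by (simp add: B_mat_def)
  have KC: "A \<in> carrier_vec ?n" if "A \<in> ?K \<sigma>" for A \<sigma>
    using mat_kernelD(1)[OF B that] .
  have "(\<Union>\<sigma> \<in> ?\<Sigma>. square_vec ` ?K \<sigma>) \<subseteq> carrier_vec ?n"
    using KC by (auto simp: square_vec_def)
  then have "dual_cone ?n (M_cone G bc vs es) =
      dual_cone ?n (\<Union>\<sigma> \<in> ?\<Sigma>. square_vec ` ?K \<sigma>)"
    by (simp only: M_cone_generated_by_representatives[where rep = rep, OF assms(6)] dual_cone_hull)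
  then have "d \<in> dual_cone ?n (M_cone G bc vs es) \<longleftrightarrow>
      (\<forall>\<sigma> \<in> ?\<Sigma>. \<forall>A \<in> ?K \<sigma>. d \<bullet> square_vec A \<ge> 0)"
    using d by (simp add: dual_cone_def)
  then have kernels: "d \<in> dual_cone ?n (M_cone G bc vs es) \<longleftrightarrow>
      (\<forall>\<sigma> \<in> ?\<Sigma>. \<forall>A \<in> ?K \<sigma>. A \<bullet> (diag_of_vec d *\<^sub>v A) \<ge> 0)"
    using KC by (simp add: diag_quadratic_form[OF d])
  have "pos_semidef ((N \<sigma>)\<^sup>T * diag_of_vec d * N \<sigma>) \<longleftrightarrow>
      (\<forall>A \<in> ?K \<sigma>. A \<bullet> (diag_of_vec d *\<^sub>v A) \<ge> 0)" if \<sigma>: "\<sigma> \<in> ?\<Sigma>" for \<sigma>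
  proof -
    note basis = assms(7)[OF \<sigma>]
    have "N \<sigma> \<in> carrier_mat ?n (dim_col (N \<sigma>))"
      using basis by (auto simp: kernel_basis_mat_def B_mat_def)
    moreover have "diag_of_vec d \<in> carrier_mat ?n ?n"
      using d by (simp add: diag_of_vec_def)
    moreover have "(diag_of_vec d)\<^sup>T = diag_of_vec d"
      by (auto simp: diag_of_vec_def mat_diag_def intro!: eq_matI)
    ultimately show ?thesis
      unfolding kernel_basis_mat_range[OF basis] by (intro pos_semidef_congruence_iff)
  qed
  with kernels show ?thesis
    by simp
qed

end
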